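(* Suppose $a\in C^2(\mathbb{R})$ satisfies $a'>0$ and $a''>0$ on $\mathbb{R}$. Let $N\geq 6$ and let $\mathcal{X}=\{X_i\}_{i=1}^N\subset K_a$ with $X_i=P(u_i,v_i)$ for $i=1,\dots,N$. If there exists $Q\in\mathbb{R}^{3\times 2}$ such that $$\mathrm{rank}\left(A_{\mathcal{X}}-\Pi^N(Q)\right)=2,$$ then $\mathcal{X}$ does not have an order that forms a $T_N$ configuration.
   Context: Given $a\in C^2(\mathbb{R})$, fix a function $F$ with $F'=a$. Define $P:\mathbb{R}^2\to\mathbb{R}^{3\times 2}$ by $$P(u,v):=\begin{bmatrix} u & v \\ a(v) & u \\ u a(v) & \frac{u^2}{2}+F(v) \end{bmatrix},\qquad K_a:=\{P(u,v):u,v\in\mathbb{R}\}\subset\mathbb{R}^{3\times 2}.$$ For $\mathcal{X}=\{X_i\}_{i=1}^N\subset K_a$ with $X_i=P(u_i,v_i)$, the matrix $A_{\mathcal{X}}\in\mathbb{R}^{3\times 2N}$ is $$A_{\mathcal{X}}:=\begin{bmatrix} u_1 & \cdots & u_N & v_1 & \cdots & v_N \\ a(v_1) & \cdots & a(v_N) & u_1 & \cdots & u_N \\ u_1 a(v_1) & \cdots & u_N a(v_N) & \frac{u_1^2}{2}+F(v_1) & \cdots & \frac{u_N^2}{2}+F(v_N) \end{bmatrix}.$$ For $Q\in\mathbb{R}^{3\times 2}$, the matrix $\Pi^N(Q)\in\mathbb{R}^{3\times 2N}$ is the matrix whose first $N$ columns are all equal to the first column of $Q$ and whose last $N$ columns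 are all equal to the second column of $Q$. $T_N$ configuration: a set contains rank-one connections if it contains $A\neq B$ with $\mathrm{rank}(A-B)=1$. An ordered set of $N\geq 4$ distinct matrices $\{X_i\}_{i=1}^N\subset\mathbb{R}^{m\times n}$ without rank-one connections is said to form a $T_N$ configuration if there exist matrices $P_0,C_1,\dots,C_N\in\mathbb{R}^{m\times n}$ and real numbers $\kappa_1,\dots,\kappa_N>1$ such that $\mathrm{rank}(C_i)=1$ for all $i$, $\sum_{i=1}^N C_i=0$, and $X_i=P_0+C_1+\dots+C_{i-1}+\kappa_iC_i$ for $i=1,\dots,N$. A set $\{X_i\}_{i=1}^N$ has an order that forms a $T_N$ configuration if for some permutation $\sigma$ of $\{1,\dots,N\}$ the ordered set $(X_{\sigma(1)},\dots,X_{\sigma(N)})$ forms a $T_N$ configuration. *)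

theory Defs
  imports "HOL-Analysis.Analysis"
begin

definition C2_real :: "(real \<Rightarrow> real) \<Rightarrow> bool" where
  "C2_real a \<longleftrightarrow> a differentiable_on UNIV \<and> deriv a differentiable_on UNIV \<and>
     continuous_on UNIV (deriv (deriv a))"

(* F is a chosen antiderivative of a. *)
definition P_mat :: "(real \<Rightarrow> real) \<Rightarrow> (real \<Rightarrow> real) \<Rightarrow> real \<Rightarrow> real \<Rightarrow> real^2^3" where
  "P_mat a F u v = vector
     [vector [u, v],
      vector [a v, u],
      vector [u * a v, u\<^sup>2 / 2 + F v]]"

definition K_set :: "(real \<Rightarrow> real) \<Rightarrow> (real \<Rightarrow> real) \<Rightarrow> (real^2^3) set" where
  "K_set a F = {P_mat a F u v | u v. True}"

(* The 2N columns are indexed by the sum type 'n + 'n with N = CARD('n):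
   Inl i stands for column i and Inr i for column N + i. *)
definition A_mat :: "(real \<Rightarrow> real) \<Rightarrow> (real \<Rightarrow> real) \<Rightarrow>
    ('n::finite \<Rightarrow> real) \<Rightarrow> ('n \<Rightarrow> real) \<Rightarrow> real^('n + 'n)^3" where
  "A_mat a F u v = vector
     [\<chi> c. case c of Inl i \<Rightarrow> u i | Inr i \<Rightarrow> v i,
      \<chi> c. case c of Inl i \<Rightarrow> a (v i) | Inr i \<Rightarrow> u i,
      \<chi> c. case c of Inl i \<Rightarrow> u i * a (v i) | Inr i \<Rightarrow> (u i)\<^sup>2 / 2 + F (v i)]"

definition Pi_mat :: "real^2^3 \<Rightarrow> real^('n::finite + 'n)^3" where
  "Pi_mat Q = (\<chi> r c. case c of Inl _ \<Rightarrow> Q $ r $ 1 | Inr _ \<Rightarrow> Q $ r $ 2)"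

definition has_rank_one_connection :: "(real^'c^'r) set \<Rightarrow> bool" where
  "has_rank_one_connection S \<longleftrightarrow> (\<exists>A\<in>S. \<exists>B\<in>S. A \<noteq> B \<and> rank (A - B) = 1)"

(* Only the values X 1, ..., X N of the sequence matter. *)
definition forms_TN :: "nat \<Rightarrow> (nat \<Rightarrow> real^'c^'r) \<Rightarrow> bool" where
  "forms_TN N X \<longleftrightarrow>
     4 \<le> N \<and> inj_on X {1..N} \<and> \<not> has_rank_one_connection (X ` {1..N}) \<and>
     (\<exists>P\<^sub>0 C (\<kappa> :: nat \<Rightarrow> real).
        (\<forall>i\<in>{1..N}. \<kappa> i > 1) \<and>
        (\<forall>i\<in>{1..N}. rank (C i) = 1) \<and>
        (\<Sum>i=1..N. C i) = 0 \<and>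
        (\<forall>i\<in>{1..N}. X i = P\<^sub>0 + (\<Sum>j=1..<i. C j) + \<kappa> i *\<^sub>R C i))"

(* Orders of a family of N = CARD('n) matrices are the enumerations
   of its index type by 1, ..., N. *)
definition has_order_forming_TN :: "('n::finite \<Rightarrow> real^'c^'r) \<Rightarrow> bool" where
  "has_order_forming_TN X \<longleftrightarrow>
     (\<exists>\<sigma>. bij_betw \<sigma> {1..CARD('n)} UNIV \<and> forms_TN CARD('n) (X \<circ> \<sigma>))"

end

(* A left kernel vector w of A - Pi confines all points (u_i, v_i) to two curves. If w_3 = 0,
   the v_i lie in one fibre of the strictly convex function a(t) - (w_1/w_2)^2 t, so there are
   at most two points. Otherwise put b = a + w_1/w_3 and U = u + w_2/w_3; then U b(v) and
   U^2/2 + F(v) + (w_1/w_3) v are constant along the points, and the strict trapezoid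
   inequality for the convex function a gives that the minor of the first two rows of
   X_i - X_j has the sign of -(b(v_i) + b(v_j)) if v_i and v_j differ. For i with |b(v_i)|
   maximal this sign does not depend on j. But the minor is affine along rank-one lines, so
   following the closed polygon of a T_N configuration from X_i, where it starts from 0, it
   would come back with a strict sign. *)
theory Submission
  imports Defs
begin

section \<open>The upper 2x2 minor along the closed polygon of a T_N configuration\<close>

definition upper_minor :: "real^2^3 \<Rightarrow> real" where
  "upper_minor Z = Z$1$1 * Z$2$2 - Z$1$2 * Z$2$1"

text \<open>With two columns, rank one leaves a nonzero kernel vector, which also annihilates the
  top 2x2 block.\<close>

lemma upper_minor_eq_0_if_rank_1:
  assumes "rank Z = 1"
  shows "upper_minor Z = 0"
proof -
  have "\<not> inj ((*v) Z)"
    using less_rank_noninjective[of Z] assms by simp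
  then obtain x where x: "Z *v x = 0" "x \<noteq> 0"
    using linear_injective_0[OF matrix_vector_mul_linear[of Z]] by auto
  have "(Z *v x)$1 = 0" "(Z *v x)$2 = 0"
    using x by auto
  then have e: "Z$1$1 * x$1 + Z$1$2 * x$2 = 0" "Z$2$1 * x$1 + Z$2$2 * x$2 = 0"
    by (simp_all add: matrix_vector_mult_def sum_2)
  have "upper_minor Z * x$1 = 0" "upper_minor Z * x$2 = 0"
    using e unfolding upper_minor_def by algebra+
  then show ?thesis
    using x(2) by (auto simp: vec_eq_iff forall_2)
qed

text \<open>Along \<open>Y + t *\<^sub>R C\<close> the coefficient of t^2 is
  \<open>upper_minor C\<close>, so the minor is affine in t. Its value at t = 1 is interpolated from
  t = 0 and t = k, with the denominator cleared.\<close>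

lemma upper_minor_affine_on_rank_1_lines:
  assumes "upper_minor C = 0"
  shows "k * upper_minor (Y + C - Z) =
    (k - 1) * upper_minor (Y - Z) + upper_minor (Y + k *\<^sub>R C - Z)"
  using assms unfolding upper_minor_def by simp algebra

text \<open>Since \<open>\<kappa> j > 1\<close>, each polygon vertex is a proper convex combination
  of its predecessor and \<open>X j\<close>, so a nonnegative value becomes positive at the next
  vertex. The factor \<open>s\<close> covers both signs.\<close>

lemma forms_TN_not_definite_at_vertex:
  fixes X :: "nat \<Rightarrow> real^2^3"
  assumes TN: "forms_TN N X" and i: "i \<in> {1..N}"
    and pos: "\<And>j. j \<in> {1..N} \<Longrightarrow> j \<noteq> i \<Longrightarrow> s * upper_minor (X j - X i) > 0"
  shows False
proof -
  obtain P\<^sub>0 C and \<kappa> :: "nat \<Rightarrow> real"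
    where \<kappa>: "\<And>j. j \<in> {1..N} \<Longrightarrow> \<kappa> j > 1"
      and C: "\<And>j. j \<in> {1..N} \<Longrightarrow> rank (C j) = 1"
      and sum_C: "(\<Sum>j=1..N. C j) = 0"
      and X: "\<And>j. j \<in> {1..N} \<Longrightarrow> X j = P\<^sub>0 + (\<Sum>l=1..<j. C l) + \<kappa> j *\<^sub>R C j"
    and N: "4 \<le> N"
    using TN unfolding forms_TN_def by blast
  define Y where "Y j = P\<^sub>0 + (\<Sum>l=1..<j. C l)" for j
  define q where "q Z = s * upper_minor (Z - X i)" for Z
  have Y_Suc: "Y (Suc j) = Y j + C j" if "j \<ge> 1" for j
    using that by (simp add: Y_def)
  have X_Y: "X j = Y j + \<kappa> j *\<^sub>R C j" if "j \<in> {1..N}" for j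
    using X[OF that] by (simp add: Y_def)
  have minor_C: "upper_minor (C j) = 0" if "j \<in> {1..N}" for j
    using C[OF that] by (rule upper_minor_eq_0_if_rank_1)
  have step: "\<kappa> j * q (Y (Suc j)) = (\<kappa> j - 1) * q (Y j) + q (X j)" if "j \<in> {1..N}" for j
  proof -
    have "\<kappa> j * upper_minor (Y j + C j - X i) =
        (\<kappa> j - 1) * upper_minor (Y j - X i) + upper_minor (X j - X i)"
      using upper_minor_affine_on_rank_1_lines[OF minor_C[OF that]] X_Y[OF that] by simp
    then have "\<kappa> j * (s * upper_minor (Y j + C j - X i)) =
        (\<kappa> j - 1) * (s * upper_minor (Y j - X i)) + s * upper_minor (X j - X i)"
      by algebra
    then show ?thesis
      using Y_Suc[of j] that by (simp add: q_def)
  qed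
  have closed: "Y (Suc N) = Y 1"
    using sum_C by (simp add: Y_def atLeastLessThanSuc_atLeastAtMost)
  \<comment> \<open>\<open>X i\<close>, \<open>Y i\<close> and \<open>Y (Suc i)\<close> lie on one
    rank-one line through \<open>X i\<close>, so \<open>q\<close> vanishes at all three.\<close>
  have scale: "upper_minor (t *\<^sub>R C i) = 0" for t
    using minor_C[OF i] by (simp add: upper_minor_def algebra_simps)
  have q_Y_i: "q (Y i) = 0"
    using scale[of "- \<kappa> i"] X_Y[OF i] by (simp add: q_def)
  have q_X_i: "q (X i) = 0"
    by (simp add: q_def upper_minor_def)
  have q_Y_Suc_i: "q (Y (Suc i)) = 0"
    using step[OF i] q_Y_i q_X_i \<kappa>[OF i] by simp
  have grow: "q (Y (Suc j)) > 0" if "q (Y j) \<ge> 0" "j \<in> {1..N}" "j \<noteq> i" for j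
  proof -
    have "(\<kappa> j - 1) * q (Y j) \<ge> 0" "q (X j) > 0"
      using that \<kappa>[of j] pos[of j] by (auto simp: q_def)
    then have "\<kappa> j * q (Y (Suc j)) > 0"
      using step[OF that(2)] by linarith
    then show ?thesis
      using \<kappa>[OF that(2)] by (simp add: zero_less_mult_iff)
  qed
  \<comment> \<open>At \<open>Suc i\<close> itself the value is only 0; strictness starts one vertex
    later.\<close>
  have after: "q (Y k) \<ge> 0 \<and> (Suc i < k \<longrightarrow> q (Y k) > 0)" if "Suc i \<le> k" "k \<le> Suc N" for k
    using that
  proof (induction k rule: dec_induct)
    case base
    then show ?case using q_Y_Suc_i by simp
  next
    case (step k)
    then show ?case using grow[of k] i by (auto intro: less_imp_le)
  qed
  \<comment> \<open>Closing up at \<open>Y (Suc N) = Y 1\<close>. For i = N no growth step has been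
    made yet, hence the weak version.\<close>
  have at_1: "q (Y 1) \<ge> 0" "i < N \<Longrightarrow> q (Y 1) > 0"
    using after[of "Suc N"] i closed by auto
  have before: "q (Y k) \<ge> 0 \<and> (1 < k \<longrightarrow> q (Y k) > 0)" if "1 \<le> k" "k \<le> i" for k
    using that
  proof (induction k rule: dec_induct)
    case base
    then show ?case using at_1 by simp
  next
    case (step k)
    then show ?case using grow[of k] i by (auto intro: less_imp_le)
  qed
  \<comment> \<open>For i = 1 the polygon has already returned to \<open>Y i\<close>, strictly
    because 1 < N; otherwise the growth from \<open>Y 1\<close> to \<open>Y i\<close> supplies
    strictness.\<close>
  show False
    using before[of i] at_1 q_Y_i i N by (cases "i = 1") auto
qed

section \<open>Consequences of strict convexity\<close>

lemma strict_trapezoid: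
  fixes F a a' :: "real \<Rightarrow> real"
  assumes F: "\<And>t. (F has_real_derivative a t) (at t)"
    and a: "\<And>t. (a has_real_derivative a' t) (at t)"
    and mono: "strict_mono a'"
    and "x < y"
  shows "F y - F x < (a x + a y) / 2 * (y - x)"
proof -
  \<comment> \<open>The error of the trapezoid rule on [x, t]. By the mean value theorem its
    derivative is (t - x)/2 times an increment of \<open>a'\<close>. It vanishes at t = x, so
    monotonicity is taken from the open interval.\<close>
  define \<phi> where "\<phi> t = (a x + a t) / 2 * (t - x) - (F t - F x)" for t
  have \<phi>': "(\<phi> has_real_derivative (a' t * (t - x) - (a t - a x)) / 2) (at t)" for t
    unfolding \<phi>_def
    by (rule derivative_eq_intros F a refl | simp add: field_simps)+
  have pos: "(a' t * (t - x) - (a t - a x)) / 2 > 0" if t: "x < t" for t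
  proof -
    obtain \<xi> where \<xi>: "x < \<xi>" "\<xi> < t" "a t - a x = (t - x) * a' \<xi>"
      using MVT2[OF t] a by metis
    have "a' \<xi> * (t - x) < a' t * (t - x)"
      using strict_monoD[OF mono \<xi>(2)] t by simp
    then show ?thesis
      using \<xi>(3) by (simp add: mult.commute)
  qed
  have "\<phi> x < \<phi> y"
  proof (rule DERIV_pos_imp_increasing_open[OF \<open>x < y\<close>])
    show "\<exists>d. (\<phi> has_real_derivative d) (at t) \<and> d > 0" if "x < t" "t < y" for t
      using \<phi>' pos[OF that(1)] by blast
    show "continuous_on {x..y} \<phi>"
      using \<phi>' by (meson DERIV_isCont continuous_at_imp_continuous_on)
  qed
  then show ?thesis
    by (simp add: \<phi>_def)
qed

text \<open>Three points of a fibre would give, by Rolle, two distinct zeros of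
  \<open>f'\<close>.\<close>

lemma card_fibre_le_2_if_deriv_strict_mono:
  fixes f f' :: "real \<Rightarrow> real"
  assumes f: "\<And>t. (f has_real_derivative f' t) (at t)"
    and mono: "strict_mono f'"
    and S: "\<And>x. x \<in> S \<Longrightarrow> f x = c"
  shows "card S \<le> 2"
proof (rule ccontr)
  assume "\<not> card S \<le> 2"
  then obtain T where T: "T \<subseteq> S" "card T = 3"
    using obtain_subset_with_card_n[of 3 S] by auto
  have no: False if xy: "x < y" and yz: "y < z" and xyz: "x \<in> S" "y \<in> S" "z \<in> S" for x y z
  proof -
    obtain p where p: "x < p" "p < y" "f y - f x = (y - x) * f' p"
      using MVT2[OF xy] f by metis
    obtain r where r: "y < r" "r < z" "f z - f y = (z - y) * f' r"
      using MVT2[OF yz] f by metis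
    have "f' p = 0" "f' r = 0"
      using p r xy yz xyz S by auto
    then show False
      using strict_monoD[OF mono, of p r] p r by simp
  qed
  obtain x y z where "T = {x, y, z}" "x \<noteq> y" "y \<noteq> z" "x \<noteq> z"
    using T(2) by (auto simp: card_3_iff)
  moreover from this have "x \<in> S" "y \<in> S" "z \<in> S"
    using T(1) by auto
  ultimately show False
    using no by (metis linorder_neqE)
qed

section \<open>The two curves given by a left kernel vector\<close>

lemma upper_minor_P_mat_diff:
  "upper_minor (P_mat a F p q - P_mat a F p' q') = (p - p')\<^sup>2 - (q - q') * (a q - a q')"
  by (simp add: upper_minor_def P_mat_def power2_eq_square algebra_simps)

text \<open>Each half of the columns of \<open>Pi_mat Q\<close> repeats one column of
  \<open>Q\<close>, so pairing with a left kernel vector gives right-hand sides independent of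
  i.\<close>

lemma left_kernel_A_mat:
  fixes u v :: "'n::finite \<Rightarrow> real"
  assumes "rank (A_mat a F u v - Pi_mat Q) < 3"
  obtains w :: "real^3" and c\<^sub>1 c\<^sub>2 where "w \<noteq> 0"
    "\<And>i. w$1 * u i + w$2 * a (v i) + w$3 * (u i * a (v i)) = c\<^sub>1"
    "\<And>i. w$1 * v i + w$2 * u i + w$3 * ((u i)\<^sup>2 / 2 + F (v i)) = c\<^sub>2"
proof -
  define B where "B = A_mat a F u v - Pi_mat Q"
  have "\<not> inj ((*v) (transpose B))"
    using less_rank_noninjective[of "transpose B"] assms by (simp add: B_def rank_transpose)
  then obtain w where w: "transpose B *v w = 0" "w \<noteq> 0"
    using linear_injective_0[OF matrix_vector_mul_linear[of "transpose B"]] by auto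
  have eq: "B$1$c * w$1 + B$2$c * w$2 + B$3$c * w$3 = 0" for c
    using arg_cong[OF w(1), of "\<lambda>z. z$c"]
    by (simp add: matrix_vector_mult_def transpose_def sum_3)
  show ?thesis
  proof (rule that[OF w(2)])
    show "w$1 * u i + w$2 * a (v i) + w$3 * (u i * a (v i)) =
        w$1 * Q$1$1 + w$2 * Q$2$1 + w$3 * Q$3$1" for i
      using eq[of "Inl i"] by (simp add: B_def A_mat_def Pi_mat_def algebra_simps)
    show "w$1 * v i + w$2 * u i + w$3 * ((u i)\<^sup>2 / 2 + F (v i)) =
        w$1 * Q$1$2 + w$2 * Q$2$2 + w$3 * Q$3$2" for i
      using eq[of "Inr i"] by (simp add: B_def A_mat_def Pi_mat_def algebra_simps)
  qed
qed

lemma card_le_2_if_kernel_third_0: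
  fixes u v :: "'n::finite \<Rightarrow> real" and w :: "real^3"
  assumes a: "\<And>t. (a has_real_derivative a' t) (at t)" and mono: "strict_mono a'"
    and inj: "\<And>i j. u i = u j \<Longrightarrow> v i = v j \<Longrightarrow> i = j"
    and "w \<noteq> 0" and w3: "w$3 = 0"
    and eq1: "\<And>i. w$1 * u i + w$2 * a (v i) = c\<^sub>1"
    and eq2: "\<And>i. w$1 * v i + w$2 * u i = c\<^sub>2"
  shows "CARD('n) \<le> 2"
proof (cases "w$2 = 0")
  case True
  then have "w$1 \<noteq> 0"
    using assms(4) w3 by (auto simp: vec_eq_iff forall_3)
  then have "u i = c\<^sub>1 / w$1 \<and> v i = c\<^sub>2 / w$1" for i
    using eq1[of i] eq2[of i] True by (simp add: field_simps)
  then have "i = j" for i j :: 'n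
    using inj by metis
  then have "card (UNIV :: 'n set) \<le> Suc 0"
    by (subst card_le_Suc0_iff_eq) auto
  then show ?thesis
    by simp
next
  case False
  \<comment> \<open>The second equation makes u affine in v with slope -r; substituting it into the
    first gives the fibre equation.\<close>
  define r where "r = w$1 / w$2"
  have u: "u i = c\<^sub>2 / w$2 - r * v i" for i
    using eq2[of i] False by (simp add: r_def field_simps)
  have fibre: "a (v i) - r\<^sup>2 * v i = c\<^sub>1 / w$2 - r * c\<^sub>2 / w$2" for i
  proof -
    have "a (v i) = c\<^sub>1 / w$2 - r * u i"
      using eq1[of i] False by (simp add: r_def field_simps)
    then show ?thesis
      by (simp add: u power2_eq_square algebra_simps)
  qed
  \<comment> \<open>As u is a function of v, distinct points have distinct v, and the fibre counts
    all indices.\<close>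
  have "inj v"
    using inj u by (metis injI)
  have "card (range v) \<le> 2"
  proof (rule card_fibre_le_2_if_deriv_strict_mono)
    show "((\<lambda>t. a t - r\<^sup>2 * t) has_real_derivative a' t - r\<^sup>2) (at t)" for t
      by (rule derivative_eq_intros a refl | simp)+
    show "strict_mono (\<lambda>t. a' t - r\<^sup>2)"
      using mono by (simp add: strict_mono_def)
    show "a x - r\<^sup>2 * x = c\<^sub>1 / w$2 - r * c\<^sub>2 / w$2" if "x \<in> range v" for x
      using that fibre by auto
  qed
  then show ?thesis
    using card_image[OF \<open>inj v\<close>] by simp
qed

lemma minor_sign:
  fixes F a a' :: "real \<Rightarrow> real"
  assumes F: "\<And>t. (F has_real_derivative a t) (at t)"
    and a: "\<And>t. (a has_real_derivative a' t) (at t)"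
    and mono: "strict_mono a" "strict_mono a'"
    and prod: "(p + \<beta>) * (a x + \<alpha>) = (q + \<beta>) * (a y + \<alpha>)"
    and energy: "(p + \<beta>)\<^sup>2 / 2 + F x + \<alpha> * x = (q + \<beta>)\<^sup>2 / 2 + F y + \<alpha> * y"
    and "x \<noteq> y"
  shows "((p - q)\<^sup>2 - (x - y) * (a x - a y)) * ((a x + \<alpha>) + (a y + \<alpha>)) < 0"
  using prod energy \<open>x \<noteq> y\<close>
proof (induction x y arbitrary: p q rule: linorder_wlog)
  case (le x y)
  then have "x < y" by simp
  have "F y - F x < (a x + a y) / 2 * (y - x)"
    using strict_trapezoid[OF F a mono(2) \<open>x < y\<close>] .
  \<comment> \<open>The energy equation turns the difference of squares into 2 (F y - F x) + 2
    \<alpha> (y - x).\<close>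
  then have "(p + \<beta>)\<^sup>2 - (q + \<beta>)\<^sup>2 < (a x + a y) * (y - x) + 2 * \<alpha> * (y - x)"
    using le.prems(2) by (simp add: field_simps)
  then have "((p + \<beta>)\<^sup>2 - (q + \<beta>)\<^sup>2) * (a y - a x) <
      ((a x + a y) * (y - x) + 2 * \<alpha> * (y - x)) * (a y - a x)"
    using strict_monoD[OF mono(1) \<open>x < y\<close>] by simp
  \<comment> \<open>Expanding (p - q)^2 as the square of (p + \<beta>) - (q + \<beta>), the product
    equation cancels the unmixed terms on both sides.\<close>
  moreover have "(p - q)\<^sup>2 * ((a x + \<alpha>) + (a y + \<alpha>)) = ((p + \<beta>)\<^sup>2 - (q + \<beta>)\<^sup>2) * (a y - a x)"
    using le.prems(1) by algebra
  ultimately show ?case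
    by (simp add: algebra_simps)
next
  case (sym x y)
  from sym.IH[of q p] sym.prems show ?case
    by (simp add: power2_commute algebra_simps)
qed

section \<open>Definiteness at a point of maximal |b|\<close>

theorem theorem1p1:
  fixes a F :: "real \<Rightarrow> real"
    and u v :: "'n::finite \<Rightarrow> real"
    and X :: "'n \<Rightarrow> real^2^3"
  assumes "C2_real a"
    and "\<And>x. (F has_real_derivative a x) (at x)"
    and "\<And>x. deriv a x > 0"
    and "\<And>x. deriv (deriv a) x > 0"
    and "CARD('n) \<ge> 6"
    and "range X \<subseteq> K_set a F"
    and "\<And>i. X i = P_mat a F (u i) (v i)"
    and "\<exists>Q :: real^2^3. rank (A_mat a F u v - Pi_mat Q) = 2"
  shows "\<not> has_order_forming_TN X"
proof
  assume "has_order_forming_TN X"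
  then obtain \<sigma> where \<sigma>: "bij_betw \<sigma> {1..CARD('n)} UNIV"
    and TN: "forms_TN CARD('n) (X \<circ> \<sigma>)"
    unfolding has_order_forming_TN_def by blast
  have "inj_on (X \<circ> \<sigma>) {1..CARD('n)}"
    using TN by (simp add: forms_TN_def)
  then have "inj X"
    using \<sigma> by (metis bij_betw_def inj_on_imageI)
  then have inj: "i = j" if "u i = u j" "v i = v j" for i j
    using that assms(7) by (metis injD)
  have a': "(a has_real_derivative deriv a x) (at x)" for x
    using assms(1) unfolding C2_real_def
    by (simp add: DERIV_deriv_iff_real_differentiable differentiable_on_def)
  have a'': "(deriv a has_real_derivative deriv (deriv a) x) (at x)" for x
    using assms(1) unfolding C2_real_def
    by (simp add: DERIV_deriv_iff_real_differentiable differentiable_on_def)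
  have mono_a: "strict_mono a"
    using a' assms(3) by (meson DERIV_pos_imp_increasing strict_monoI)
  have mono_a': "strict_mono (deriv a)"
    using a'' assms(4) by (meson DERIV_pos_imp_increasing strict_monoI)
  obtain Q where "rank (A_mat a F u v - Pi_mat Q) = 2"
    using assms(8) by blast
  then have "rank (A_mat a F u v - Pi_mat Q) < 3"
    by simp
  then obtain w :: "real^3" and c\<^sub>1 c\<^sub>2 where "w \<noteq> 0"
    and eq1: "\<And>i. w$1 * u i + w$2 * a (v i) + w$3 * (u i * a (v i)) = c\<^sub>1"
    and eq2: "\<And>i. w$1 * v i + w$2 * u i + w$3 * ((u i)\<^sup>2 / 2 + F (v i)) = c\<^sub>2"
    by (rule left_kernel_A_mat) blast
  have w3: "w$3 \<noteq> 0"
  proof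
    assume "w$3 = 0"
    then have "CARD('n) \<le> 2"
      using card_le_2_if_kernel_third_0[OF a' mono_a' inj \<open>w \<noteq> 0\<close>] eq1 eq2 by simp
    then show False
      using assms(5) by simp
  qed
  define \<alpha> where "\<alpha> = w$1 / w$3"
  define \<beta> where "\<beta> = w$2 / w$3"
  have w12: "w$1 = w$3 * \<alpha>" "w$2 = w$3 * \<beta>"
    using w3 by (simp_all add: \<alpha>_def \<beta>_def)
  \<comment> \<open>Dividing by \<open>w$3\<close>, the first equation is completed to a product and
    the second to a square; this adds the constants \<alpha> \<beta> and \<beta>^2 / 2.\<close>
  define b where "b i = a (v i) + \<alpha>" for i
  have prod: "(u i + \<beta>) * b i = c\<^sub>1 / w$3 + \<alpha> * \<beta>" for i
  proof -
    have "w$3 * ((u i + \<beta>) * b i) = c\<^sub>1 + w$3 * (\<alpha> * \<beta>)"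
      using eq1[of i] by (simp add: w12 b_def algebra_simps)
    then show ?thesis
      using w3 by (simp add: field_simps)
  qed
  have energy: "(u i + \<beta>)\<^sup>2 / 2 + F (v i) + \<alpha> * v i = c\<^sub>2 / w$3 + \<beta>\<^sup>2 / 2" for i
  proof -
    have "w$3 * ((u i + \<beta>)\<^sup>2 / 2 + F (v i) + \<alpha> * v i) = c\<^sub>2 + w$3 * (\<beta>\<^sup>2 / 2)"
      using eq2[of i] by (simp add: w12 power2_eq_square field_simps)
    then show ?thesis
      using w3 by (simp add: field_simps)
  qed
  have sign: "upper_minor (X j - X i) * (b j + b i) < 0" if "v j \<noteq> v i" for i j
    using minor_sign[OF assms(2) a' mono_a mono_a' _ _ that, of "u j" \<beta> \<alpha> "u i"]
      prod[of i] prod[of j] energy[of i] energy[of j]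
    by (simp add: assms(7) upper_minor_P_mat_diff b_def)
  \<comment> \<open>Two points with the same v are mirror images under u + \<beta> -> -(u +
    \<beta>), and equality of their products then forces b = 0.\<close>
  have opposite: "u j + \<beta> = - (u i + \<beta>) \<and> b i = 0" if "v j = v i" "j \<noteq> i" for i j
  proof -
    have "u j \<noteq> u i"
      using inj that by metis
    moreover have "(u j + \<beta>)\<^sup>2 = (u i + \<beta>)\<^sup>2"
      using energy[of i] energy[of j] that by simp
    ultimately have neg: "u j + \<beta> = - (u i + \<beta>)"
      by (auto simp: power2_eq_iff)
    moreover have "(u j - u i) * b i = 0"
      using prod[of i] prod[of j] that by (simp add: b_def algebra_simps)
    ultimately show ?thesis
      using \<open>u j \<noteq> u i\<close> by simp
  qed
  have "Max (range (\<lambda>j. \<bar>b j\<bar>)) \<in> range (\<lambda>j. \<bar>b j\<bar>)"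
    by (rule Max_in) auto
  then obtain i where "Max (range (\<lambda>j. \<bar>b j\<bar>)) = \<bar>b i\<bar>"
    by blast
  then have max: "\<bar>b j\<bar> \<le> \<bar>b i\<bar>" for j
    using Max_ge[of "range (\<lambda>j. \<bar>b j\<bar>)" "\<bar>b j\<bar>"] by simp
  \<comment> \<open>Otherwise every b vanishes and all v agree; any point other than i is then the
    mirror image of i, leaving at most two points.\<close>
  have "b i \<noteq> 0"
  proof
    assume "b i = 0"
    then have "a (v j) = a (v i)" for j
      using max[of j] max[of i] by (simp add: b_def)
    then have v: "v j = v i" for j
      using strict_mono_eq[OF mono_a] by blast
    have two: "j = i \<or> j = k" if "k \<noteq> i" for j k
    proof (rule disjCI)
      assume "j \<noteq> k"
      then have "u j \<noteq> u k"
        using inj v by metis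
      then show "j = i"
        using opposite[OF v[of j]] opposite[OF v[of k] that] by fastforce
    qed
    have "\<exists>k. UNIV \<subseteq> {i, k}"
      using two by (cases "\<exists>k. k \<noteq> i") auto
    then obtain k where "(UNIV :: 'n set) \<subseteq> {i, k}" ..
    then have "CARD('n) \<le> card {i, k}"
      by (intro card_mono) auto
    also have "\<dots> \<le> 2"
      by (simp add: card_insert_if)
    finally show False
      using assms(5) by simp
  qed
  \<comment> \<open>By maximality \<open>b j + b i\<close> is zero or has the sign of
    \<open>b i\<close>; the strict product inequality excludes zero. This fixes the factor s as
    \<open>- b i\<close>.\<close>
  have definite: "- b i * upper_minor (X j - X i) > 0" if "j \<noteq> i" for j
  proof -
    have *: "upper_minor (X j - X i) * (b j + b i) < 0"
      using sign opposite[of j i] that \<open>b i \<noteq> 0\<close> by blast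
    show ?thesis
    proof (cases "b i > 0")
      case True
      then have "b j + b i \<ge> 0"
        using max[of j] by linarith
      then have "upper_minor (X j - X i) < 0"
        using * by (simp add: mult_less_0_iff)
      then show ?thesis
        using True by (simp add: mult_pos_neg)
    next
      case False
      then have "b j + b i \<le> 0"
        using max[of j] by linarith
      then have "upper_minor (X j - X i) > 0"
        using * by (simp add: mult_less_0_iff)
      then show ?thesis
        using False \<open>b i \<noteq> 0\<close> by (simp add: mult_neg_pos)
    qed
  qed
  obtain n where n: "n \<in> {1..CARD('n)}" "\<sigma> n = i"
    using \<sigma> by (metis UNIV_I bij_betw_def imageE)
  show False
  proof (rule forms_TN_not_definite_at_vertex[OF TN n(1)])
    fix m assume "m \<in> {1..CARD('n)}" "m \<noteq> n"
    then have "\<sigma> m \<noteq> i"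
      using \<sigma> n by (metis bij_betw_imp_inj_on inj_on_eq_iff)
    then show "- b i * upper_minor ((X \<circ> \<sigma>) m - (X \<circ> \<sigma>) n) > 0"
      using definite n(2) by simp
  qed
qed

end
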